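(* Let $G$ be a totally disconnected locally compact group, $\alpha\in\mathrm{End}(G)$ and $U\le G$ a compact open subgroup. Then there is $N\in\mathbb{N}$ such that $U_Nv_{-1}=U_+v_{-1}$, and $U_{-N}$ is tidy above for $\alpha$.
   Context: $\mathrm{End}(G)$ is the semigroup of continuous homomorphisms $G\to G$; $\alpha^{-k}$ denotes preimage under $\alpha^k$. For a compact open subgroup $W\le G$ set $W_0:=W$, $W_{n+1}:=W\cap\alpha(W_n)$ and $W_{-n}:=\bigcap_{k=0}^n\alpha^{-k}(W)$ for $n\in\mathbb{N}_0$; $W_+:=\bigcap_{n\in\mathbb{N}_0}W_n$ and $W_-:=\bigcap_{n\in\mathbb{N}_0}W_{-n}$. $W$ is tidy above for $\alpha$ if $W=W_+W_-$. Here $v_{-1}:=\alpha^{-1}(U)$, viewed as an element of the power set of $G$ on which $G$ acts by left multiplication, and for $A\subseteq G$, $Av_{-1}:=\{a\,\alpha^{-1}(U)\mid a\in A\}$ is a set of left cosets of $\alpha^{-1}(U)$. *)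

theory Defs
  imports "HOL-Analysis.Analysis" "HOL-Algebra.Coset"
begin

locale topological_group = group G for G (structure) +
  fixes T :: "'a topology"
  assumes topspace_eq: "topspace T = carrier G"
    and continuous_mult: "continuous_map (prod_topology T T) T (\<lambda>(x, y). x \<otimes> y)"
    and continuous_inv: "continuous_map T T (\<lambda>x. inv x)"

definition totally_disconnected_space :: "'a topology \<Rightarrow> bool" where
  "totally_disconnected_space T \<longleftrightarrow>
     (\<forall>S. connectedin T S \<longrightarrow> (\<forall>x\<in>S. \<forall>y\<in>S. x = y))"

text \<open>Locally compact groups are Hausdorff by convention. Here this is no restriction: points of a
  totally disconnected space are closed, and a topological group with closed points is Hausdorff.\<close>

locale tdlc_group = topological_group +
  assumes hausdorff: "Hausdorff_space T"
    and locally_compact: "locally_compact_space T"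
    and totally_disconnected: "totally_disconnected_space T"

definition continuous_endos :: "('a, 'b) monoid_scheme \<Rightarrow> 'a topology \<Rightarrow> ('a \<Rightarrow> 'a) set" where
  "continuous_endos G T = {\<alpha> \<in> hom G G. continuous_map T T \<alpha>}"

definition compact_open_subgroup :: "('a, 'b) monoid_scheme \<Rightarrow> 'a topology \<Rightarrow> 'a set \<Rightarrow> bool" where
  "compact_open_subgroup G T W \<longleftrightarrow> subgroup W G \<and> compactin T W \<and> openin T W"

text \<open>The preimage of \<open>W\<close> under the \<open>k\<close>-th iterate of \<open>\<alpha>\<close>, taken in the group: the values of \<open>\<alpha>\<close>
  outside the carrier are arbitrary.\<close>

definition iter_preimage ::
    "('a, 'b) monoid_scheme \<Rightarrow> ('a \<Rightarrow> 'a) \<Rightarrow> nat \<Rightarrow> 'a set \<Rightarrow> 'a set" where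
  "iter_preimage G \<alpha> k W = {x \<in> carrier G. (\<alpha> ^^ k) x \<in> W}"

text \<open>\<open>fwd \<alpha> W n\<close>, \<open>bwd G \<alpha> W n\<close>, \<open>fwd_inf \<alpha> W\<close> and \<open>bwd_inf G \<alpha> W\<close> are
  \<open>W\<^sub>n\<close>, \<open>W\<^sub>-\<^sub>n\<close>, \<open>W\<^sub>+\<close> and \<open>W\<^sub>-\<close>, respectively.\<close>

primrec fwd :: "('a \<Rightarrow> 'a) \<Rightarrow> 'a set \<Rightarrow> nat \<Rightarrow> 'a set" where
  "fwd \<alpha> W 0 = W"
| "fwd \<alpha> W (Suc n) = W \<inter> \<alpha> ` fwd \<alpha> W n"

definition bwd :: "('a, 'b) monoid_scheme \<Rightarrow> ('a \<Rightarrow> 'a) \<Rightarrow> 'a set \<Rightarrow> nat \<Rightarrow> 'a set" where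
  "bwd G \<alpha> W n = (\<Inter>k\<in>{0..n}. iter_preimage G \<alpha> k W)"

definition fwd_inf :: "('a \<Rightarrow> 'a) \<Rightarrow> 'a set \<Rightarrow> 'a set" where
  "fwd_inf \<alpha> W = (\<Inter>n. fwd \<alpha> W n)"

definition bwd_inf :: "('a, 'b) monoid_scheme \<Rightarrow> ('a \<Rightarrow> 'a) \<Rightarrow> 'a set \<Rightarrow> 'a set" where
  "bwd_inf G \<alpha> W = (\<Inter>n. bwd G \<alpha> W n)"

definition tidy_above :: "('a, 'b) monoid_scheme \<Rightarrow> ('a \<Rightarrow> 'a) \<Rightarrow> 'a set \<Rightarrow> bool" where
  "tidy_above G \<alpha> W \<longleftrightarrow> W = fwd_inf \<alpha> W <#>\<^bsub>G\<^esub> bwd_inf G \<alpha> W"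

text \<open>\<open>translates G A v\<close> is \<open>A v = {a v | a \<in> A}\<close> for a point \<open>v\<close> of the power set of the group,
  on which the group acts by left multiplication: a set of subsets, not their union.\<close>

definition translates :: "('a, 'b) monoid_scheme \<Rightarrow> 'a set \<Rightarrow> 'a set \<Rightarrow> 'a set set" where
  "translates G A v = {a <#\<^bsub>G\<^esub> v | a. a \<in> A}"

text \<open>Tidiness above is a notion for compact open subgroups; the following makes it applicable to
  \<open>W\<^sub>-\<^sub>n\<close>.\<close>

lemma (in tdlc_group) compact_open_subgroup_bwd:
  assumes \<alpha>: "\<alpha> \<in> continuous_endos G T" and W: "compact_open_subgroup G T W"
  shows "compact_open_subgroup G T (bwd G \<alpha> W n)"
proof -
  have hom: "(\<alpha> ^^ k) \<in> hom G G" and cont: "continuous_map T T (\<alpha> ^^ k)" for k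
    using \<alpha> by (induction k)
      (auto simp: continuous_endos_def hom_def Pi_iff intro: continuous_map_compose)
  have sub: "subgroup W G" and cpt: "compactin T W" and opn: "openin T W"
    using W by (auto simp: compact_open_subgroup_def)
  have cls: "closedin T W"
    using compactin_imp_closedin[OF hausdorff cpt] .
  have presub: "subgroup (iter_preimage G \<alpha> k W) G" for k
  proof -
    interpret h: group_hom G G "\<alpha> ^^ k"
      using hom[of k] by unfold_locales
    show ?thesis
      unfolding iter_preimage_def
      using sub by unfold_locales (auto simp: subgroup.m_closed subgroup.one_closed subgroup.m_inv_closed)
  qed
  have preopn: "openin T (iter_preimage G \<alpha> k W)" for k
    using openin_continuous_map_preimage[OF cont[of k] opn]
    by (simp add: iter_preimage_def topspace_eq)
  have precls: "closedin T (iter_preimage G \<alpha> k W)" for k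
    using closedin_continuous_map_preimage[OF cont[of k] cls]
    by (simp add: iter_preimage_def topspace_eq)
  have "subgroup (bwd G \<alpha> W n) G"
    unfolding bwd_def by (rule subgroups_Inter) (use presub in auto)
  moreover have "openin T (bwd G \<alpha> W n)"
    unfolding bwd_def by (rule openin_INT2) (use preopn in auto)
  moreover have "closedin T (bwd G \<alpha> W n)"
    unfolding bwd_def by (rule closedin_INT) (use precls in auto)
  moreover have "bwd G \<alpha> W n \<subseteq> W"
    by (force simp: bwd_def iter_preimage_def)
  ultimately show ?thesis
    using cpt closed_compactin unfolding compact_open_subgroup_def by blast
qed

end

theory Submission
  imports Defs
begin

text \<open>Write \<open>V = \<alpha>\<^sup>-\<^sup>1(U)\<close>, an open subgroup. The product \<open>U\<^sub>+ V\<close> is open, being a union of cosets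
  of \<open>V\<close>, and it contains the intersection \<open>U\<^sub>+\<close> of the decreasing compact sets \<open>U\<^sub>n\<close>. Hence it
  contains some \<open>U\<^sub>N\<close> (lemma \<open>fwd_eventually_subset_open\<close>), which is the equality of the two sets of
  cosets.

  For tidiness above let \<open>W = U\<^sub>-\<^sub>N\<close>; clearly \<open>W\<^sub>- = U\<^sub>-\<close>. The main step (lemma \<open>bwd_step\<close>) is
  \<open>U\<^sub>-\<^sub>n \<subseteq> W\<^sub>+ U\<^bsub>-(n+1)\<^esub>\<close> for \<open>n \<ge> N\<close>. If \<open>x \<in> U\<^sub>-\<^sub>n\<close>, then \<open>\<alpha>\<^sup>n(x) \<in> U\<^sub>n \<subseteq> U\<^sub>N \<subseteq> U\<^sub>+ V\<close>, say
  \<open>\<alpha>\<^sup>n(x) = u v\<close>. Compactness gives \<open>U\<^sub>+ \<subseteq> \<alpha>(U\<^sub>+)\<close>, so \<open>u = \<alpha>\<^sup>n(y)\<close> for some \<open>y\<close> whose orbit stays in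
  \<open>U\<^sub>+\<close> up to time \<open>n\<close>; as \<open>n \<ge> N\<close>, this forces \<open>y \<in> W\<^sub>+\<close>. Now \<open>y\<^sup>-\<^sup>1 x\<close> lies in \<open>U\<^sub>-\<^sub>n\<close>, and its
  image \<open>v\<close> under \<open>\<alpha>\<^sup>n\<close> lies in \<open>V\<close>, so it lies in \<open>U\<^bsub>-(n+1)\<^esub>\<close>. Iterating,
  \<open>W = W\<^sub>+ U\<^sub>-\<^sub>n\<close> for all \<open>n \<ge> N\<close>, and compactness of \<open>W\<^sub>+\<close> turns this into \<open>W = W\<^sub>+ U\<^sub>-\<close>.\<close>

section \<open>Nested compact sets\<close>

lemma nested_compactin_nonempty:
  fixes K :: "nat \<Rightarrow> 'a set"
  assumes haus: "Hausdorff_space T"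
    and cpt: "\<And>n. compactin T (K n)" and ne: "\<And>n. K n \<noteq> {}"
    and dec: "\<And>n. K (Suc n) \<subseteq> K n"
  shows "(\<Inter>n. K n) \<noteq> {}"
proof -
  have anti: "K n \<subseteq> K m" if "m \<le> n" for m n
    using lift_Suc_antimono_le[of K] dec that by blast
  have "K 0 \<inter> \<Inter>(range K) \<noteq> {}"
  proof (rule compactin_fip[THEN iffD1, OF cpt, THEN conjunct2, rule_format], intro conjI ballI allI impI)
    show "closedin T C" if "C \<in> range K" for C
      using that compactin_imp_closedin[OF haus cpt] by auto
    fix \<F> assume "finite \<F> \<and> \<F> \<subseteq> range K"
    then obtain I where I: "finite I" "\<F> = K ` I"
      using finite_subset_image[of \<F> K UNIV] by auto
    have "K (Max (insert 0 I)) \<subseteq> K i" if "i \<in> insert 0 I" for i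
      using I(1) that by (intro anti Max_ge) auto
    then have "K (Max (insert 0 I)) \<subseteq> K 0 \<inter> \<Inter>\<F>"
      unfolding I(2) by blast
    then show "K 0 \<inter> \<Inter>\<F> \<noteq> {}"
      using ne by blast
  qed
  then show ?thesis by blast
qed

section \<open>Forward and backward orbits of a continuous endomorphism\<close>

locale tdlc_group_endo = tdlc_group +
  fixes \<alpha> :: "'a \<Rightarrow> 'a"
  assumes endo: "\<alpha> \<in> continuous_endos G T"
begin

lemma hom_funpow: "(\<alpha> ^^ k) \<in> hom G G"
  using endo by (induction k) (auto simp: continuous_endos_def hom_def Pi_iff)

lemma group_hom_funpow: "group_hom G G (\<alpha> ^^ k)"
  using hom_funpow by unfold_locales

lemma continuous_endo: "continuous_map T T \<alpha>"
  using endo by (simp add: continuous_endos_def)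

lemma continuous_left_translation:
  assumes "a \<in> carrier G"
  shows "continuous_map T T (\<lambda>x. a \<otimes> x)"
proof -
  have "continuous_map T (prod_topology T T) (\<lambda>x. (a, x))"
    using assms by (auto simp: continuous_map_pairwise o_def topspace_eq)
  from continuous_map_compose[OF this continuous_mult] show ?thesis
    by (simp add: o_def)
qed

lemma continuous_inv_right_translation:
  assumes "a \<in> carrier G"
  shows "continuous_map T T (\<lambda>x. inv x \<otimes> a)"
proof -
  have "continuous_map T (prod_topology T T) (\<lambda>x. (inv x, a))"
    using assms continuous_inv by (auto simp: continuous_map_pairwise o_def topspace_eq)
  from continuous_map_compose[OF this continuous_mult] show ?thesis
    by (simp add: o_def)
qed

lemma mem_bwd_iff: "x \<in> bwd G \<alpha> W n \<longleftrightarrow> x \<in> carrier G \<and> (\<forall>k\<le>n. (\<alpha> ^^ k) x \<in> W)"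
  by (auto simp: bwd_def iter_preimage_def)

lemma bwd_Suc_subset: "bwd G \<alpha> W (Suc n) \<subseteq> bwd G \<alpha> W n"
  by (auto simp: bwd_def)

lemma mem_bwd_inf_iff: "x \<in> bwd_inf G \<alpha> W \<longleftrightarrow> x \<in> carrier G \<and> (\<forall>k. (\<alpha> ^^ k) x \<in> W)"
  by (auto simp: bwd_inf_def mem_bwd_iff)

lemma bwd_inf_bwd: "bwd_inf G \<alpha> (bwd G \<alpha> W n) = bwd_inf G \<alpha> W"
proof -
  have "(\<alpha> ^^ k) x \<in> carrier G" if "x \<in> carrier G" for k x
    using hom_funpow that by (auto simp: hom_def)
  moreover have "(\<alpha> ^^ i) ((\<alpha> ^^ k) x) = (\<alpha> ^^ (i + k)) x" for i k x
    by (simp add: funpow_add)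
  ultimately have "x \<in> bwd_inf G \<alpha> (bwd G \<alpha> W n) \<longleftrightarrow> x \<in> bwd_inf G \<alpha> W" for x
    unfolding mem_bwd_inf_iff mem_bwd_iff by (metis add_0 le0)
  then show ?thesis by blast
qed

lemma fwd_Suc_subset: "fwd \<alpha> W (Suc n) \<subseteq> fwd \<alpha> W n"
  by (induction n) auto

lemma fwd_antimono: "m \<le> n \<Longrightarrow> fwd \<alpha> W n \<subseteq> fwd \<alpha> W m"
  using lift_Suc_antimono_le[of "fwd \<alpha> W"] fwd_Suc_subset by blast

lemma fwd_inf_subset: "fwd_inf \<alpha> W \<subseteq> W"
  unfolding fwd_inf_def by (metis INF_lower UNIV_I fwd.simps(1))

lemma subset_fwd_inf:
  assumes "A \<subseteq> W" "A \<subseteq> \<alpha> ` A"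
  shows "A \<subseteq> fwd_inf \<alpha> W"
proof -
  have "A \<subseteq> fwd \<alpha> W n" for n
    using assms by (induction n) (simp, fastforce)
  then show ?thesis by (auto simp: fwd_inf_def)
qed

lemma funpow_bwd_mem_fwd:
  assumes "x \<in> bwd G \<alpha> W n"
  shows "(\<alpha> ^^ n) x \<in> fwd \<alpha> W n"
  using assms by (induction n) (auto simp: mem_bwd_iff)

lemma subgroup_fwd:
  assumes "subgroup W G"
  shows "subgroup (fwd \<alpha> W n) G"
proof (induction n)
  case (Suc n)
  interpret group_hom G G \<alpha>
    using group_hom_funpow[of 1] by simp
  show ?case
    using subgroups_Inter_pair[OF assms subgroup_img_is_subgroup[OF Suc]] by simp
qed (use assms in simp)

lemma subgroup_fwd_inf:
  assumes "subgroup W G"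
  shows "subgroup (fwd_inf \<alpha> W) G"
  unfolding fwd_inf_def by (rule subgroups_Inter) (use subgroup_fwd[OF assms] in auto)

lemma compactin_fwd:
  assumes "compactin T W"
  shows "compactin T (fwd \<alpha> W n)"
proof (induction n)
  case (Suc n)
  have "compactin T (\<alpha> ` fwd \<alpha> W n)"
    using image_compactin[OF Suc continuous_endo] .
  then show ?case
    using closed_Int_compactin[OF compactin_imp_closedin[OF hausdorff assms]] by simp
qed (use assms in simp)

lemma compactin_fwd_inf:
  assumes "compactin T W"
  shows "compactin T (fwd_inf \<alpha> W)"
proof (rule closed_compactin[OF assms fwd_inf_subset])
  show "closedin T (fwd_inf \<alpha> W)"
    unfolding fwd_inf_def
    by (rule closedin_INT) (use compactin_imp_closedin[OF hausdorff compactin_fwd[OF assms]] in auto)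
qed

text \<open>For \<open>x \<in> W\<^sub>+\<close> the fibres of \<open>\<alpha>\<close> over \<open>x\<close> in the \<open>W\<^sub>n\<close> are nonempty, nested and compact, so a
  single preimage of \<open>x\<close> works for all \<open>n\<close>.\<close>

lemma fwd_inf_subset_image:
  assumes "compactin T W"
  shows "fwd_inf \<alpha> W \<subseteq> \<alpha> ` fwd_inf \<alpha> W"
proof
  fix x assume x: "x \<in> fwd_inf \<alpha> W"
  define K where "K n = {y \<in> topspace T. \<alpha> y \<in> {x}} \<inter> fwd \<alpha> W n" for n
  have "x \<in> topspace T"
    using x fwd_inf_subset assms compactin_subset_topspace by blast
  then have "closedin T {y \<in> topspace T. \<alpha> y \<in> {x}}"
    by (intro closedin_continuous_map_preimage[OF continuous_endo])
      (rule closedin_Hausdorff_singleton[OF hausdorff])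
  then have "compactin T (K n)" for n
    unfolding K_def using compactin_fwd[OF assms] by (rule closed_Int_compactin)
  moreover have "K n \<noteq> {}" for n
  proof -
    have "x \<in> fwd \<alpha> W (Suc n)"
      using x unfolding fwd_inf_def by (rule INT_D) simp
    then show ?thesis
      using compactin_subset_topspace[OF compactin_fwd[OF assms, of n]]
      by (auto simp: K_def)
  qed
  moreover have "K (Suc n) \<subseteq> K n" for n
    using fwd_Suc_subset by (auto simp: K_def)
  ultimately have "(\<Inter>n. K n) \<noteq> {}"
    by (rule nested_compactin_nonempty[OF hausdorff])
  then obtain y where "\<And>n. y \<in> K n"
    by blast
  then have "\<alpha> y = x" "y \<in> fwd_inf \<alpha> W"
    by (simp_all add: K_def fwd_inf_def)
  then show "x \<in> \<alpha> ` fwd_inf \<alpha> W"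
    by blast
qed

lemma fwd_inf_backward_orbit:
  assumes "compactin T W" "u \<in> fwd_inf \<alpha> W"
  obtains y where "(\<alpha> ^^ n) y = u" "\<And>j. j \<le> n \<Longrightarrow> (\<alpha> ^^ j) y \<in> fwd_inf \<alpha> W"
proof -
  have "\<exists>y. (\<alpha> ^^ n) y = u \<and> (\<forall>j\<le>n. (\<alpha> ^^ j) y \<in> fwd_inf \<alpha> W)"
  proof (induction n)
    case 0
    show ?case using assms by auto
  next
    case (Suc n)
    then obtain y where y: "(\<alpha> ^^ n) y = u" "\<And>j. j \<le> n \<Longrightarrow> (\<alpha> ^^ j) y \<in> fwd_inf \<alpha> W"
      by blast
    from y(2)[of 0] obtain z where z: "z \<in> fwd_inf \<alpha> W" "y = \<alpha> z"
      using fwd_inf_subset_image[OF assms(1)] by auto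
    have "(\<alpha> ^^ j) z \<in> fwd_inf \<alpha> W" if "j \<le> Suc n" for j
      using that y(2) z by (cases j) (simp_all add: funpow_swap1)
    moreover have "(\<alpha> ^^ Suc n) z = u"
      using y(1) z(2) by (simp add: funpow_swap1)
    ultimately show ?case by blast
  qed
  then show ?thesis using that by blast
qed

text \<open>An orbit segment of length \<open>N\<close> inside \<open>U\<^sub>+\<close> starts in \<open>(U\<^sub>-\<^sub>N)\<^sub>+\<close>: its starting point has an
  infinite backward orbit in \<open>U\<^sub>+\<close>, every point of which continues forward within \<open>U\<close> for at least
  \<open>N\<close> steps.\<close>

lemma orbit_in_fwd_inf_imp_mem_fwd_inf_bwd:
  assumes U: "compactin T U"
    and y: "\<And>j. j \<le> N \<Longrightarrow> (\<alpha> ^^ j) y \<in> fwd_inf \<alpha> U"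
  shows "y \<in> fwd_inf \<alpha> (bwd G \<alpha> U N)"
proof -
  define A where "A = {y. \<forall>j\<le>N. (\<alpha> ^^ j) y \<in> fwd_inf \<alpha> U}"
  have memU: "z \<in> fwd_inf \<alpha> U" if "z \<in> A" for z
    using that by (force simp: A_def)
  have "A \<subseteq> bwd G \<alpha> U N"
  proof
    fix z assume z: "z \<in> A"
    have "z \<in> carrier G"
      using memU[OF z] fwd_inf_subset compactin_subset_topspace[OF U] topspace_eq by blast
    then show "z \<in> bwd G \<alpha> U N"
      using z fwd_inf_subset by (auto simp: mem_bwd_iff A_def)
  qed
  moreover have "A \<subseteq> \<alpha> ` A"
  proof
    fix z assume z: "z \<in> A"
    then obtain w where w: "w \<in> fwd_inf \<alpha> U" "z = \<alpha> w"
      using memU fwd_inf_subset_image[OF U] by blast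
    have "(\<alpha> ^^ j) w \<in> fwd_inf \<alpha> U" if "j \<le> N" for j
      using that z w by (cases j) (auto simp: funpow_swap1 A_def)
    then show "z \<in> \<alpha> ` A"
      using w by (auto simp: A_def)
  qed
  ultimately have "A \<subseteq> fwd_inf \<alpha> (bwd G \<alpha> U N)"
    by (rule subset_fwd_inf)
  then show ?thesis using y by (auto simp: A_def)
qed

section \<open>Cosets of the preimage of a compact open subgroup\<close>

text \<open>Otherwise the sets \<open>W\<^sub>n - S\<close> would be nonempty, nested and compact, and a common point of them
  would lie in \<open>W\<^sub>+\<close> but not in \<open>S\<close>.\<close>

lemma fwd_eventually_subset_open:
  assumes "compactin T W" "openin T S" "fwd_inf \<alpha> W \<subseteq> S"
  obtains N where "fwd \<alpha> W N \<subseteq> S"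
proof (rule ccontr)
  assume "\<not> thesis"
  then have "fwd \<alpha> W n - S \<noteq> {}" for n
    using that by blast
  moreover have "compactin T (fwd \<alpha> W n - S)" for n
  proof -
    have "fwd \<alpha> W n - S = (topspace T - S) \<inter> fwd \<alpha> W n"
      using compactin_subset_topspace[OF compactin_fwd[OF assms(1)]] by blast
    also have "compactin T \<dots>"
      by (intro closed_Int_compactin compactin_fwd closedin_diff closedin_topspace assms)
    finally show ?thesis .
  qed
  moreover have "fwd \<alpha> W (Suc n) - S \<subseteq> fwd \<alpha> W n - S" for n
    using fwd_Suc_subset by blast
  ultimately have "(\<Inter>n. fwd \<alpha> W n - S) \<noteq> {}"
    by (intro nested_compactin_nonempty[OF hausdorff])
  then show False
    using assms(3) by (auto simp: fwd_inf_def)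
qed

lemma openin_union_left_cosets:
  assumes "openin T V" "A \<subseteq> carrier G"
  shows "openin T {x \<in> carrier G. \<exists>a\<in>A. inv a \<otimes> x \<in> V}"
proof -
  have "openin T {x \<in> topspace T. inv a \<otimes> x \<in> V}" if "a \<in> A" for a
    using that assms by (intro openin_continuous_map_preimage[OF continuous_left_translation]) auto
  then have "openin T (\<Union>a\<in>A. {x \<in> topspace T. inv a \<otimes> x \<in> V})"
    by blast
  also have "(\<Union>a\<in>A. {x \<in> topspace T. inv a \<otimes> x \<in> V}) = {x \<in> carrier G. \<exists>a\<in>A. inv a \<otimes> x \<in> V}"
    by (auto simp: topspace_eq)
  finally show ?thesis .
qed

text \<open>The conclusion \<open>U\<^sub>N \<subseteq> U\<^sub>+ V\<close>, with \<open>V = \<alpha>\<^sup>-\<^sup>1(U)\<close>, is all that the equality of coset sets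
  and tidiness above use of \<open>N\<close>.\<close>

lemma fwd_eventually_in_cosets:
  assumes "compact_open_subgroup G T U"
  obtains N where "N \<ge> 1"
    and "\<And>x. x \<in> fwd \<alpha> U N \<Longrightarrow> \<exists>u\<in>fwd_inf \<alpha> U. inv u \<otimes> x \<in> iter_preimage G \<alpha> 1 U"
proof -
  let ?V = "iter_preimage G \<alpha> 1 U"
  let ?S = "{x \<in> carrier G. \<exists>u\<in>fwd_inf \<alpha> U. inv u \<otimes> x \<in> ?V}"
  from assms have U: "subgroup U G" "compactin T U" "openin T U"
    by (auto simp: compact_open_subgroup_def)
  have plus: "fwd_inf \<alpha> U \<subseteq> carrier G"
    using subgroup.subset[OF subgroup_fwd_inf[OF U(1)]] .
  have "openin T ?V"
    using openin_continuous_map_preimage[OF continuous_endo U(3)]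
    by (simp add: iter_preimage_def topspace_eq)
  then have "openin T ?S"
    using plus by (rule openin_union_left_cosets)
  moreover have "\<one> \<in> ?V"
    using group_hom.hom_one[OF group_hom_funpow[of 1]] subgroup.one_closed[OF U(1)]
    by (simp add: iter_preimage_def)
  then have "fwd_inf \<alpha> U \<subseteq> ?S"
    using plus by (force simp: subset_iff)
  ultimately obtain N where "fwd \<alpha> U N \<subseteq> ?S"
    using fwd_eventually_subset_open U(2) by blast
  \<comment> \<open>The inclusion persists when the index grows, so a positive index is available.\<close>
  then have "fwd \<alpha> U (Suc N) \<subseteq> ?S"
    using fwd_Suc_subset by blast
  then show ?thesis
    by (intro that[of "Suc N"]) auto
qed

lemma translates_fwd_eq:
  assumes U: "compact_open_subgroup G T U"
    and N: "\<And>x. x \<in> fwd \<alpha> U N \<Longrightarrow> \<exists>u\<in>fwd_inf \<alpha> U. inv u \<otimes> x \<in> iter_preimage G \<alpha> 1 U"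
  shows "translates G (fwd \<alpha> U N) (iter_preimage G \<alpha> 1 U)
    = translates G (fwd_inf \<alpha> U) (iter_preimage G \<alpha> 1 U)"
proof -
  let ?V = "iter_preimage G \<alpha> 1 U"
  from U have sub: "subgroup U G"
    by (simp add: compact_open_subgroup_def)
  interpret h: group_hom G G "\<alpha>"
    using group_hom_funpow[of 1] by simp
  have V: "subgroup ?V G"
    unfolding iter_preimage_def using sub
    by unfold_locales (auto simp: subgroup.m_closed subgroup.one_closed subgroup.m_inv_closed)
  have "x <# ?V \<in> translates G (fwd_inf \<alpha> U) ?V" if x: "x \<in> fwd \<alpha> U N" for x
  proof -
    obtain u where u: "u \<in> fwd_inf \<alpha> U" "inv u \<otimes> x \<in> ?V"
      using N[OF x] by blast
    have "x \<in> carrier G" "u \<in> carrier G"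
      using x u subgroup.mem_carrier subgroup_fwd[OF sub] subgroup_fwd_inf[OF sub] by metis+
    then have "x \<in> u <# ?V"
      using u(2) by (auto simp: l_coset_def inv_solve_left' intro!: bexI[of _ "inv u \<otimes> x"])
        (simp flip: m_assoc)
    then have "u <# ?V = x <# ?V"
      using l_repr_independence[OF _ \<open>u \<in> carrier G\<close> V] by blast
    then show ?thesis
      using u(1) by (auto simp: translates_def)
  qed
  then show ?thesis
    by (auto simp: translates_def fwd_inf_def)
qed

section \<open>Tidiness above\<close>

text \<open>Correcting \<open>x\<close> on the left by an element of \<open>(U\<^sub>-\<^sub>N)\<^sub>+\<close> keeps its orbit in \<open>U\<close> for one more step:
  the correction is the start of an orbit in \<open>U\<^sub>+\<close> ending, after \<open>n\<close> steps, in the representative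
  from \<open>U\<^sub>+\<close> of the coset of \<open>\<alpha>\<^sup>n(x)\<close>.\<close>

lemma bwd_step:
  assumes U: "compact_open_subgroup G T U"
    and N: "\<And>x. x \<in> fwd \<alpha> U N \<Longrightarrow> \<exists>u\<in>fwd_inf \<alpha> U. inv u \<otimes> x \<in> iter_preimage G \<alpha> 1 U"
    and n: "N \<le> n" and x: "x \<in> bwd G \<alpha> U n"
  obtains y where "y \<in> fwd_inf \<alpha> (bwd G \<alpha> U N)" "inv y \<otimes> x \<in> bwd G \<alpha> U (Suc n)"
proof -
  from U have cpt: "compactin T U" and Usub: "U \<subseteq> carrier G"
    by (auto simp: compact_open_subgroup_def dest: subgroup.subset)
  interpret h: group_hom G G "\<alpha> ^^ n"
    by (rule group_hom_funpow)
  have "subgroup (bwd G \<alpha> U n) G"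
    using compact_open_subgroup_bwd[OF endo U] by (auto simp: compact_open_subgroup_def)
  then interpret B: subgroup "bwd G \<alpha> U n" G .
  have "(\<alpha> ^^ n) x \<in> fwd \<alpha> U N"
    using funpow_bwd_mem_fwd[OF x] fwd_antimono[OF n] by blast
  then obtain u where u: "u \<in> fwd_inf \<alpha> U" "inv u \<otimes> (\<alpha> ^^ n) x \<in> iter_preimage G \<alpha> 1 U"
    using N by blast
  obtain y where y: "(\<alpha> ^^ n) y = u" "\<And>j. j \<le> n \<Longrightarrow> (\<alpha> ^^ j) y \<in> fwd_inf \<alpha> U"
    using fwd_inf_backward_orbit[OF cpt u(1)] by blast
  have yW: "y \<in> fwd_inf \<alpha> (bwd G \<alpha> U N)"
    using orbit_in_fwd_inf_imp_mem_fwd_inf_bwd[OF cpt] y(2) n by force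
  have orb: "(\<alpha> ^^ j) y \<in> U" if "j \<le> n" for j
    using y(2)[OF that] fwd_inf_subset by blast
  have "y \<in> bwd G \<alpha> U n"
    using orb orb[of 0] Usub by (auto simp: mem_bwd_iff)
  then have z: "inv y \<otimes> x \<in> bwd G \<alpha> U n" "y \<in> carrier G" "x \<in> carrier G"
    using x by auto
  have "(\<alpha> ^^ n) (inv y \<otimes> x) = inv u \<otimes> (\<alpha> ^^ n) x"
    using z y(1) by simp
  then have "(\<alpha> ^^ Suc n) (inv y \<otimes> x) \<in> U"
    using u(2) by (simp add: iter_preimage_def)
  then have "inv y \<otimes> x \<in> bwd G \<alpha> U (Suc n)"
    using z(1) unfolding mem_bwd_iff le_Suc_eq by blast
  with yW show ?thesis by (rule that)
qed

text \<open>The corrections made in successive steps multiply to a single one, as \<open>(U\<^sub>-\<^sub>N)\<^sub>+\<close> is a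
  subgroup.\<close>

lemma bwd_factorization:
  assumes U: "compact_open_subgroup G T U"
    and N: "\<And>x. x \<in> fwd \<alpha> U N \<Longrightarrow> \<exists>u\<in>fwd_inf \<alpha> U. inv u \<otimes> x \<in> iter_preimage G \<alpha> 1 U"
    and x: "x \<in> bwd G \<alpha> U N"
  shows "\<exists>y\<in>fwd_inf \<alpha> (bwd G \<alpha> U N). inv y \<otimes> x \<in> bwd G \<alpha> U (N + k)"
proof -
  let ?P = "fwd_inf \<alpha> (bwd G \<alpha> U N)"
  have "subgroup ?P G"
    using compact_open_subgroup_bwd[OF endo U] subgroup_fwd_inf
    by (auto simp: compact_open_subgroup_def)
  then interpret P: subgroup ?P G .
  have xG: "x \<in> carrier G"
    using x by (simp add: mem_bwd_iff)
  show ?thesis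
  proof (induction k)
    case 0
    show ?case
      using x xG by (auto intro!: bexI[of _ \<one>])
  next
    case (Suc k)
    then obtain y where y: "y \<in> ?P" "inv y \<otimes> x \<in> bwd G \<alpha> U (N + k)"
      by blast
    obtain z where z: "z \<in> ?P" "inv z \<otimes> (inv y \<otimes> x) \<in> bwd G \<alpha> U (Suc (N + k))"
      using bwd_step[where N = N, OF U N le_add1 y(2)] by blast
    have "inv (y \<otimes> z) \<otimes> x = inv z \<otimes> (inv y \<otimes> x)"
      using y(1) z(1) xG by (simp add: inv_mult_group m_assoc)
    then show ?case
      using y z by (intro bexI[of _ "y \<otimes> z"]) auto
  qed
qed

lemma tidy_above_bwd:
  assumes U: "compact_open_subgroup G T U"
    and N: "\<And>x. x \<in> fwd \<alpha> U N \<Longrightarrow> \<exists>u\<in>fwd_inf \<alpha> U. inv u \<otimes> x \<in> iter_preimage G \<alpha> 1 U"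
  shows "tidy_above G \<alpha> (bwd G \<alpha> U N)"
proof -
  let ?W = "bwd G \<alpha> U N"
  have cos: "compact_open_subgroup G T (bwd G \<alpha> U n)" for n
    by (rule compact_open_subgroup_bwd[OF endo U])
  then have W: "subgroup ?W G" "compactin T ?W"
    by (auto simp: compact_open_subgroup_def)
  interpret W: subgroup ?W G by (rule W(1))
  have "?W \<subseteq> fwd_inf \<alpha> ?W <#> bwd_inf G \<alpha> ?W"
  proof
    fix x assume x: "x \<in> ?W"
    \<comment> \<open>The elements of \<open>W\<^sub>+\<close> that bring \<open>x\<close> into \<open>U\<^bsub>-(N+k)\<^esub>\<close> form nested compact sets, and a common
      point of them brings \<open>x\<close> into \<open>W\<^sub>-\<close>.\<close>
    define K where
      "K k = {y \<in> topspace T. inv y \<otimes> x \<in> bwd G \<alpha> U (N + k)} \<inter> fwd_inf \<alpha> ?W" for k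
    have "closedin T (bwd G \<alpha> U n)" for n
      using cos compactin_imp_closedin[OF hausdorff] by (auto simp: compact_open_subgroup_def)
    then have "closedin T {y \<in> topspace T. inv y \<otimes> x \<in> bwd G \<alpha> U n}" for n
      by (intro closedin_continuous_map_preimage[OF continuous_inv_right_translation]) (use x in auto)
    then have "compactin T (K k)" for k
      unfolding K_def using compactin_fwd_inf[OF W(2)] by (rule closed_Int_compactin)
    moreover have "K k \<noteq> {}" for k
    proof -
      obtain y where y: "y \<in> fwd_inf \<alpha> ?W" "inv y \<otimes> x \<in> bwd G \<alpha> U (N + k)"
        using bwd_factorization[OF U N x] by blast
      then have "y \<in> topspace T"
        using compactin_subset_topspace[OF compactin_fwd_inf[OF W(2)]] by blast
      with y show ?thesis
        unfolding K_def by blast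
    qed
    moreover have "K (Suc k) \<subseteq> K k" for k
      unfolding K_def add_Suc_right using bwd_Suc_subset by blast
    ultimately have "(\<Inter>k. K k) \<noteq> {}"
      by (rule nested_compactin_nonempty[OF hausdorff])
    then obtain y where "\<And>k. y \<in> K k"
      by blast
    then have y: "y \<in> fwd_inf \<alpha> ?W" "inv y \<otimes> x \<in> bwd G \<alpha> U (N + k)" for k
      by (simp_all add: K_def)
    have "inv y \<otimes> x \<in> bwd_inf G \<alpha> ?W"
      unfolding bwd_inf_bwd mem_bwd_inf_iff using y(2) unfolding mem_bwd_iff by (meson le_add2)
    moreover have "y \<in> carrier G"
      using y(1) fwd_inf_subset W.subset by blast
    then have "x = y \<otimes> (inv y \<otimes> x)"
      using x by (simp flip: m_assoc)
    ultimately show "x \<in> fwd_inf \<alpha> ?W <#> bwd_inf G \<alpha> ?W"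
      using y(1) unfolding set_mult_def by blast
  qed
  moreover have "bwd_inf G \<alpha> ?W \<subseteq> ?W"
    unfolding bwd_inf_bwd by (simp add: bwd_inf_def INT_lower)
  then have "fwd_inf \<alpha> ?W <#> bwd_inf G \<alpha> ?W \<subseteq> ?W"
    using fwd_inf_subset by (auto simp: set_mult_def)
  ultimately show ?thesis
    unfolding tidy_above_def by blast
qed

end

section \<open>Stabilization of cosets and tidiness above\<close>

theorem theorem3p4:
  fixes G :: "('a, 'b) monoid_scheme" and T :: "'a topology"
    and \<alpha> :: "'a \<Rightarrow> 'a" and U :: "'a set"
  assumes "tdlc_group G T"
    and "\<alpha> \<in> continuous_endos G T"
    and "compact_open_subgroup G T U"
  shows "\<exists>N::nat. N \<ge> 1 \<and>
           translates G (fwd \<alpha> U N) (iter_preimage G \<alpha> 1 U)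
             = translates G (fwd_inf \<alpha> U) (iter_preimage G \<alpha> 1 U) \<and>
           tidy_above G \<alpha> (bwd G \<alpha> U N)"
proof -
  interpret tdlc_group_endo G T \<alpha>
    using assms(1,2) by (simp add: tdlc_group_endo_def tdlc_group_endo_axioms_def)
  show ?thesis
    using fwd_eventually_in_cosets[OF assms(3)] translates_fwd_eq[OF assms(3)]
      tidy_above_bwd[OF assms(3)] by metis
qed

end
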